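(* Let $L_3$ be the 2-tape language over the alphabet $\Sigma=\{1,\nabla\}$ given by $$L_3=\{(x_1\nabla x_2\nabla x_3,\;y_1\nabla y_2)\;:\;x_1,x_2,x_3,y_1,y_2\in\{1\}^*,\ \text{there is exactly one } k\in\{1,2\}\text{ such that there are exactly two } j\in\{1,2,3\}\text{ with } x_j=y_k\}.$$ For every $\varepsilon>0$ there exists a probabilistic 2-tape finite automaton which recognizes $L_3$ with probability $\frac{13}{25}-\varepsilon$.
   Context: A 2-tape language over $\Sigma$ is a set of pairs of words $L\subseteq\Sigma^*\times\Sigma^*$ (first component: content of tape 1; second component: content of tape 2). A probabilistic 2-tape finite automaton is a one-way two-tape machine with finitely many states, one of them initial, and some of them designated as accepting or rejecting halting states. Tape $i$ holds the input word $x^i$ between endmarkers, $\kappa x^i\$$, with one read-only head per tape starting on $\kappa$. In each step, depending on the current state and the pair of scanned symbols, it chooses at random (according to a fixed probability distribution depending only on these data) a new state and, for each head, whether it stays or moves one cell to the right; heads never move left or beyond $\$$. On entering a halting state the computation stops and the input is accepted or rejected accordingly. An automaton recognizes $L$ with probability $p$ if every input in $L$ is accepted with probability at least $p$ and every input not in $L$ is rejected with probability at least $p$. *)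

theory Defs
  imports "HOL-Probability.Probability"
begin

datatype 'a tape_symbol = Left_End | Letter 'a | Right_End

datatype head_move = Stay | Advance

record ('s, 'a) two_tape_pfa =
  states :: "'s set"
  initial :: 's
  accepting :: "'s set"
  rejecting :: "'s set"
  trans :: "'s \<Rightarrow> 'a tape_symbol \<Rightarrow> 'a tape_symbol \<Rightarrow> ('s \<times> head_move \<times> head_move) pmf"

(* The alphabet is the whole letter type 'a.  The values of trans at halting states and
   outside the state set are irrelevant, hence unconstrained. *)
definition wf_two_tape_pfa :: "('s, 'a) two_tape_pfa \<Rightarrow> bool" where
  "wf_two_tape_pfa A \<longleftrightarrow>
     finite (states A) \<and>
     initial A \<in> states A \<and>
     accepting A \<subseteq> states A \<and>
     rejecting A \<subseteq> states A \<and>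
     accepting A \<inter> rejecting A = {} \<and>
     (\<forall>q \<in> states A - (accepting A \<union> rejecting A). \<forall>a b.
        \<forall>(q', m1, m2) \<in> set_pmf (trans A q a b).
          q' \<in> states A \<and>
          (a = Right_End \<longrightarrow> m1 = Stay) \<and>
          (b = Right_End \<longrightarrow> m2 = Stay))"

definition tape :: "'a list \<Rightarrow> 'a tape_symbol list" where
  "tape w = Left_End # map Letter w @ [Right_End]"

fun move_head :: "head_move \<Rightarrow> nat \<Rightarrow> nat" where
  "move_head Stay i = i"
| "move_head Advance i = Suc i"

(* A configuration (q, i, j) consists of the state and the two head positions, where
   position 0 is the left endmarker.  Halting configurations are made absorbing. *)
fun step ::
  "('s, 'a) two_tape_pfa \<Rightarrow> 'a list \<Rightarrow> 'a list \<Rightarrow> 's \<times> nat \<times> nat \<Rightarrow> ('s \<times> nat \<times> nat) pmf" where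
  "step A u v (q, i, j) =
     (if q \<in> accepting A \<union> rejecting A then return_pmf (q, i, j)
      else map_pmf (\<lambda>(q', m1, m2). (q', move_head m1 i, move_head m2 j))
             (trans A q (tape u ! i) (tape v ! j)))"

fun run :: "('s, 'a) two_tape_pfa \<Rightarrow> 'a list \<Rightarrow> 'a list \<Rightarrow> nat \<Rightarrow> ('s \<times> nat \<times> nat) pmf" where
  "run A u v 0 = return_pmf (initial A, 0, 0)"
| "run A u v (Suc n) = bind_pmf (run A u v n) (step A u v)"

definition prob_within ::
  "('s, 'a) two_tape_pfa \<Rightarrow> 's set \<Rightarrow> 'a list \<Rightarrow> 'a list \<Rightarrow> nat \<Rightarrow> real" where
  "prob_within A H u v n = measure_pmf.prob (run A u v n) {c. fst c \<in> H}"

(* Since halting configurations are absorbing, the n-th term of each supremum is the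
   probability of having accepted (rejected) within n steps.  These events increase with n,
   so the supremum is the probability that the computation ever accepts (rejects). *)
definition accept_prob :: "('s, 'a) two_tape_pfa \<Rightarrow> 'a list \<Rightarrow> 'a list \<Rightarrow> real" where
  "accept_prob A u v = (SUP n. prob_within A (accepting A) u v n)"

definition reject_prob :: "('s, 'a) two_tape_pfa \<Rightarrow> 'a list \<Rightarrow> 'a list \<Rightarrow> real" where
  "reject_prob A u v = (SUP n. prob_within A (rejecting A) u v n)"

definition recognizes :: "('s, 'a) two_tape_pfa \<Rightarrow> ('a list \<times> 'a list) set \<Rightarrow> real \<Rightarrow> bool" where
  "recognizes A L p \<longleftrightarrow>
     (\<forall>u v. ((u, v) \<in> L \<longrightarrow> accept_prob A u v \<ge> p) \<and>
            ((u, v) \<notin> L \<longrightarrow> reject_prob A u v \<ge> p))"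

datatype letter = One | Nabla

definition L3 :: "(letter list \<times> letter list) set" where
  "L3 = {(x 1 @ [Nabla] @ x 2 @ [Nabla] @ x 3, y 1 @ [Nabla] @ y 2) | (x :: nat \<Rightarrow> _) (y :: nat \<Rightarrow> _).
           (\<forall>j \<in> {1, 2, 3}. x j \<in> lists {One}) \<and>
           (\<forall>k \<in> {1, 2}. y k \<in> lists {One}) \<and>
           (\<exists>!k. k \<in> {1, 2} \<and> card {j \<in> {1, 2, 3}. x j = y k} = 2)}"

lemma incseq_prob_within:
  assumes "H \<subseteq> accepting A \<union> rejecting A"
  shows "incseq (prob_within A H u v)"
proof (rule incseq_SucI)
  fix n
  let ?C = "{c :: 'a \<times> nat \<times> nat. fst c \<in> H}"
  have "emeasure (measure_pmf (run A u v n)) ?C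
      = (\<integral>\<^sup>+c. indicator ?C c \<partial>measure_pmf (run A u v n))"
    by simp
  also have "\<dots> \<le> (\<integral>\<^sup>+c. emeasure (measure_pmf (step A u v c)) ?C \<partial>measure_pmf (run A u v n))"
  proof (rule nn_integral_mono)
    fix c :: "'a \<times> nat \<times> nat"
    obtain q i j where "c = (q, i, j)" by (cases c)
    with assms show "indicator ?C c \<le> emeasure (measure_pmf (step A u v c)) ?C"
      by (cases "q \<in> H") (auto simp: indicator_def)
  qed
  also have "\<dots> = emeasure (measure_pmf (run A u v (Suc n))) ?C"
    by (simp add: emeasure_bind_pmf)
  finally show "prob_within A H u v n \<le> prob_within A H u v (Suc n)"
    unfolding prob_within_def by (simp add: measure_pmf.emeasure_eq_measure)
qed

lemma prob_within_tendsto_SUP: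
  assumes "H \<subseteq> accepting A \<union> rejecting A"
  shows "prob_within A H u v \<longlonglongrightarrow> (SUP n. prob_within A H u v n)"
  by (rule LIMSEQ_incseq_SUP)
     (auto simp: incseq_prob_within[OF assms] prob_within_def intro!: bdd_aboveI[where M = 1])

end

(* Write E_jk for the event x_j = y_k.  For any set of pairs (j, k), the conjunction of the E_jk
   can be tested with one-sided error: choose r at random in {1..N} and check the single linear
   equation in which the differences x_j - y_k are weighted by 1, r, r^2, ....  Moving the y_k to
   the other side makes all coefficients nonnegative, so one simultaneous scan of both tapes,
   always reading the tape that lags behind, checks it with a bounded counter.  If some difference
   is nonzero, fewer values of r satisfy the equation than there are pairs.

   The automaton picks one of 25 tests uniformly: 7 reject; 6 accept iff x_i = x_j = y_k (i < j);
   3 + 3 accept iff not x_1 = x_2 = x_3 = y_k; 2 + 2 + 2 accept iff not x_i = x_j = y_1 = y_2.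
   With error-free tests, 6 + 6 + 1 = 13 of them accept an input of the language.  For other inputs
   at most 12 accept: the extra accepting pair tests caused by three equal x_j, or by y_1 = y_2,
   are paid for by rejecting tests of the last two kinds. *)

theory Submission
  imports Defs "HOL-Computational_Algebra.Polynomial"
begin

section \<open>Weighted block lengths and Horner coefficients\<close>

text \<open>Each \<open>One\<close> is charged \<open>f\<close> of the number of separators before
  it, so the result is the sum over j of \<open>f j\<close> times the length of block j.\<close>

fun weight :: "(nat \<Rightarrow> nat) \<Rightarrow> letter list \<Rightarrow> nat" where
  "weight f [] = 0"
| "weight f (One # w) = f 0 + weight f w"
| "weight f (Nabla # w) = weight (\<lambda>j. f (Suc j)) w"

definition block :: "letter list \<Rightarrow> nat \<Rightarrow> nat" where
  "block w i = weight (\<lambda>j. of_bool (j = i)) w"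

text \<open>The scan extends the prefix read so far at its right end, whereas the recursion of
  \<open>weight\<close> strips letters at the left.\<close>

lemma weight_snoc:
  "weight f (w @ [a]) = weight f w + (if a = One then f (count_list w Nabla) else 0)"
  by (induction f w rule: weight.induct) (simp_all, cases a, simp_all)

lemma weight_zero [simp]: "weight (\<lambda>_. 0) w = 0"
proof (induction w)
  case (Cons a w)
  then show ?case by (cases a) (simp_all add: comp_def)
qed simp

lemma weight_linear: "weight (\<lambda>j. f j + r * g j) w = weight f w + r * weight g w"
proof (induction w arbitrary: f g)
  case (Cons a w)
  then show ?case by (cases a) (simp_all add: comp_def algebra_simps)
qed simp

lemma weight_replicate_One [simp]: "weight f (replicate n One @ w) = n * f 0 + weight f w"
  by (induction n) simp_all

text \<open>This is the coefficient of block j: the sum of \<open>r ^ m\<close> over the positions m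
  of j in the list. A block occurring in several equations collects several powers.\<close>

fun horner :: "nat list \<Rightarrow> nat \<Rightarrow> nat \<Rightarrow> nat" where
  "horner [] r j = 0"
| "horner (i # is) r j = of_bool (j = i) + r * horner is r j"

lemma horner_le: "horner is r j \<le> Suc r ^ length is"
proof (induction "is")
  case (Cons i "is")
  have "horner (i # is) r j \<le> 1 + r * Suc r ^ length is"
    unfolding horner.simps by (intro add_mono mult_le_mono2 Cons) simp
  then show ?case
    using one_le_power[of "Suc r" "length is"]
    by (simp only: list.size power_Suc mult_Suc add_0_right add_Suc_right) linarith
qed simp

lemma horner_outside: "j \<notin> set is \<Longrightarrow> horner is r j = 0"
  by (induction "is") auto

lemma weight_horner_Cons:
  "weight (horner (i # is) r) w = block w i + r * weight (horner is r) w"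
proof -
  have "horner (i # is) r = (\<lambda>j. of_bool (j = i) + r * horner is r j)"
    by (rule ext) simp
  then show ?thesis
    by (simp add: block_def weight_linear)
qed

text \<open>By linearity of \<open>weight\<close> both sides unfold by the same Horner recursion.
  Balance at r thus means that r is a root of the polynomial of differences.\<close>

lemma weight_horner_diff:
  "int (weight (horner (map fst es) r) u) - int (weight (horner (map snd es) r) v) =
     poly (Poly (map (\<lambda>(j, k). int (block u j) - int (block v k)) es)) (int r)"
proof (induction es)
  case Nil
  have "horner [] r = (\<lambda>_. 0)" by auto
  then show ?case by simp
next
  case (Cons e es)
  then show ?case
    by (cases e) (simp add: weight_horner_Cons algebra_simps flip: Cons del: horner.simps)
qed

section \<open>Spurious balance and polynomial roots\<close>

lemma card_poly_roots_nat:
  fixes p :: "int poly"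
  assumes "p \<noteq> 0"
  shows "finite {r::nat. poly p (int r) = 0}" "card {r::nat. poly p (int r) = 0} \<le> degree p"
proof -
  have sub: "int ` {r. poly p (int r) = 0} \<subseteq> {x. poly p x = 0}" by auto
  have fin: "finite {x. poly p x = 0}" using assms by (rule poly_roots_finite)
  show "finite {r::nat. poly p (int r) = 0}"
    using finite_subset[OF sub fin] by (rule finite_imageD) simp
  show "card {r::nat. poly p (int r) = 0} \<le> degree p"
    using card_mono[OF fin sub] card_poly_roots_bound[OF assms]
    by (simp add: card_image)
qed

text \<open>A test \<open>(c, es)\<close> accepts iff the truth value of the conjunction of the equations in \<open>es\<close>
  is \<open>c\<close>; in particular \<open>(False, [])\<close> always rejects.  Blocks are numbered from 0.\<close>

type_synonym test = "bool \<times> (nat \<times> nat) list"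

definition equal_on :: "(nat \<times> nat) list \<Rightarrow> letter list \<Rightarrow> letter list \<Rightarrow> bool" where
  "equal_on es u v \<longleftrightarrow> (\<forall>(j, k) \<in> set es. block u j = block v k)"

definition balanced :: "(nat \<times> nat) list \<Rightarrow> nat \<Rightarrow> letter list \<Rightarrow> letter list \<Rightarrow> bool" where
  "balanced es r u v \<longleftrightarrow> weight (horner (map fst es) r) u = weight (horner (map snd es) r) v"

lemma balanced_iff_root:
  "balanced es r u v \<longleftrightarrow>
     poly (Poly (map (\<lambda>(j, k). int (block u j) - int (block v k)) es)) (int r) = 0"
  unfolding balanced_def weight_horner_diff[symmetric] by simp

lemma Poly_diff_eq_0_iff:
  "Poly (map (\<lambda>(j, k). int (block u j) - int (block v k)) es) = 0 \<longleftrightarrow> equal_on es u v"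
  by (induction es) (auto simp: equal_on_def)

lemma balanced_if_equal_on: "equal_on es u v \<Longrightarrow> balanced es r u v"
  unfolding balanced_iff_root Poly_diff_eq_0_iff[symmetric] by simp

lemma card_spurious_balance:
  assumes "\<not> equal_on es u v"
  shows "finite {r. balanced es r u v}" "card {r. balanced es r u v} < length es"
proof -
  define p where "p = Poly (map (\<lambda>(j, k). int (block u j) - int (block v k)) es)"
  have nz: "p \<noteq> 0" using assms by (simp add: p_def Poly_diff_eq_0_iff)
  have eq: "{r. balanced es r u v} = {r. poly p (int r) = 0}"
    by (simp add: balanced_iff_root p_def)
  show "finite {r. balanced es r u v}" using card_poly_roots_nat(1)[OF nz] eq by simp
  \<comment> \<open>Nonemptiness turns the degree bound \<open>length es - 1\<close> into a strict
    bound on the number of roots.\<close>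
  have "es \<noteq> []" using nz by (auto simp: p_def)
  moreover have "degree p \<le> length es - 1"
    using length_strip_while_le[of "(=) 0" "map (\<lambda>(j, k). int (block u j) - int (block v k)) es"]
    by (simp add: p_def degree_eq_length_coeffs diff_le_mono)
  ultimately show "card {r. balanced es r u v} < length es"
    using card_poly_roots_nat(2)[OF nz] eq by (cases es) auto
qed

section \<open>The clipped counter and the automaton\<close>

definition clip :: "int \<Rightarrow> int \<Rightarrow> int" where
  "clip m z = max (- m) (min m z)"

type_synonym scan_state = "(test \<times> nat) \<times> nat \<times> nat \<times> int"

text \<open>Of the natural numbers that serve as states, 0 is initial, 1 accepts and 2 rejects.
  In a scanning state \<open>(d, p, q, z)\<close>, the numbers \<open>p\<close> and \<open>q\<close> count the separators read so far,
  capped at 3, and \<open>z\<close> is the clipped counter.\<close>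

definition running :: "scan_state \<Rightarrow> nat" where
  "running s = 3 + to_nat s"

text \<open>By \<open>horner_le\<close> this dominates the weight of every single letter, so a
  lagging tape overtakes by at most this amount in one step.\<close>

definition bound :: "test \<times> nat \<Rightarrow> int" where
  "bound d = int (Suc (snd d) ^ length (snd (fst d)))"

definition weight1 :: "test \<times> nat \<Rightarrow> nat \<Rightarrow> nat" where
  "weight1 d = horner (map fst (snd (fst d))) (snd d)"

definition weight2 :: "test \<times> nat \<Rightarrow> nat \<Rightarrow> nat" where
  "weight2 d = horner (map snd (snd (fst d))) (snd d)"

text \<open>The sign of the counter tells which tape lags; once one tape is exhausted, the other is
  read whatever the sign. The fallback branches concern \<open>Left_End\<close>, which is not
  scanned after the first step of a run.\<close>

fun scan_step :: "scan_state \<Rightarrow> letter tape_symbol \<Rightarrow> letter tape_symbol \<Rightarrow> nat \<times> head_move \<times> head_move" where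
  "scan_step (d, p, q, z) a b =
     (if a = Right_End \<and> b = Right_End
        then (if p = 2 \<and> q = 1 \<and> (z = 0 \<longleftrightarrow> fst (fst d)) then 1 else 2, Stay, Stay)
      else if b = Right_End \<or> (z \<le> 0 \<and> a \<noteq> Right_End) then
        (case a of
           Letter One \<Rightarrow> (running (d, p, q, clip (bound d) (z + int (weight1 d p))), Advance, Stay)
         | Letter Nabla \<Rightarrow> (running (d, min 3 (Suc p), q, z), Advance, Stay)
         | _ \<Rightarrow> (2, Stay, Stay))
      else
        (case b of
           Letter One \<Rightarrow> (running (d, p, q, clip (bound d) (z - int (weight2 d q))), Stay, Advance)
         | Letter Nabla \<Rightarrow> (running (d, p, min 3 (Suc q), z), Stay, Advance)
         | _ \<Rightarrow> (2, Stay, Stay)))"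

declare scan_step.simps [simp del]

text \<open>The draw selects an index into \<open>ts\<close>, so repeated tests count with
  multiplicity. Rejecting in state 0 on other symbols keeps the heads from advancing beyond
  \<open>Right_End\<close>.\<close>

definition machine :: "test list \<Rightarrow> nat \<Rightarrow> (nat, letter) two_tape_pfa" where
  "machine ts N =
     \<lparr>states = {0, 1, 2} \<union> running ` (SIGMA d : set ts \<times> {1..N}. {..3} \<times> {..3} \<times> {- bound d .. bound d}),
      initial = 0, accepting = {1}, rejecting = {2},
      trans = (\<lambda>s a b. if s = 0 \<and> a = Left_End \<and> b = Left_End
        then map_pmf (\<lambda>(i, r). (running ((ts ! i, r), 0, 0, 0), Advance, Advance))
               (pmf_of_set ({..<length ts} \<times> {1..N}))
        else if s = 0 then return_pmf (2, Stay, Stay)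
        else return_pmf (scan_step (from_nat (s - 3)) a b))\<rparr>"

lemma running_simps [simp]:
  "running s > 0"
  "running s \<noteq> 0" "running s \<noteq> 1" "running s \<noteq> 2" "running s \<noteq> Suc 0"
  "from_nat (running s - 3) = s"
  by (simp_all add: running_def)

lemma bound_pos: "bound d \<ge> 1"
  unfolding bound_def using one_le_power[of "Suc (snd d)"] by (simp add: int_one_le_iff_zero_less)

lemma weight1_le: "int (weight1 d p) \<le> bound d"
  unfolding weight1_def bound_def of_nat_le_iff
  using horner_le[of "map fst (snd (fst d))"] by simp

lemma weight2_le: "int (weight2 d p) \<le> bound d"
  unfolding weight2_def bound_def of_nat_le_iff
  using horner_le[of "map snd (snd (fst d))"] by simp

lemma clip_bounds: "m \<ge> 0 \<Longrightarrow> - m \<le> clip m z \<and> clip m z \<le> m"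
  by (auto simp: clip_def)

text \<open>A value above m is clipped to m and stays there after an increase. Only clipping from
  below could distort the sum, and the lower bound on z excludes it.\<close>

lemma clip_add:
  assumes "0 \<le> w" "- m \<le> z"
  shows "clip m (clip m z + w) = clip m (z + w)"
  using assms by (auto simp: clip_def max_def min_def)

lemma clip_diff:
  assumes "0 \<le> w" "z \<le> m" "0 \<le> m"
  shows "clip m (clip m z - w) = clip m (z - w)"
  using assms by (auto simp: clip_def max_def min_def)

lemma clip_sign:
  assumes "1 \<le> m"
  shows "clip m z \<le> 0 \<longleftrightarrow> z \<le> 0" "clip m z = 0 \<longleftrightarrow> z = 0"
  using assms by (auto simp: clip_def max_def min_def)

lemma wf_machine:
  assumes "ts \<noteq> []" "N > 0"
  shows "wf_two_tape_pfa (machine ts N)"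
proof -
  have fin: "finite (states (machine ts N))"
    by (auto simp: machine_def intro!: finite_SigmaI finite_imageI)
  have set_P: "set_pmf (pmf_of_set ({..<length ts} \<times> {1..N})) = {..<length ts} \<times> {1..N}"
    using assms by (intro set_pmf_of_set) auto
  have start: "running ((ts ! i, r), 0, 0, 0) \<in> states (machine ts N)"
    if "i < length ts" "r \<in> {1..N}" for i r
    using that bound_pos[of "(ts ! i, r)"] by (auto simp: machine_def intro!: imageI)
  have scan: "fst (scan_step s a b) \<in> states (machine ts N) \<and>
      (a = Right_End \<longrightarrow> fst (snd (scan_step s a b)) = Stay) \<and>
      (b = Right_End \<longrightarrow> snd (snd (scan_step s a b)) = Stay)"
    if "s \<in> (SIGMA d : set ts \<times> {1..N}. {..3} \<times> {..3} \<times> {- bound d .. bound d})" for s a b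
  proof -
    obtain d p q z where s: "s = (d, p, q, z)" by (cases s) auto
    have "bound d \<ge> 0" using bound_pos[of d] by simp
    note clip_bounds[OF this]
    then show ?thesis using that
      by (auto simp: s machine_def scan_step.simps split: tape_symbol.split letter.split intro!: imageI)
  qed
  have "q' \<in> states (machine ts N) \<and> (a = Right_End \<longrightarrow> m1 = Stay) \<and> (b = Right_End \<longrightarrow> m2 = Stay)"
    if "s \<in> states (machine ts N) - (accepting (machine ts N) \<union> rejecting (machine ts N))"
      "(q', m1, m2) \<in> set_pmf (trans (machine ts N) s a b)" for s a b q' m1 m2
  proof (cases "s = 0")
    case True
    with that(2) start set_P show ?thesis
      by (auto simp: machine_def split: if_splits)
  next
    case False
    with that(1) obtain s' where s': "s = running s'"
      "s' \<in> (SIGMA d : set ts \<times> {1..N}. {..3} \<times> {..3} \<times> {- bound d .. bound d})"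
      by (auto simp: machine_def)
    have eq: "(q', m1, m2) = scan_step s' a b"
      using that(2) unfolding s'(1) by (simp add: machine_def)
    show ?thesis
      using scan[OF s'(2), of a b] unfolding eq[symmetric] by simp
  qed
  then have "\<forall>s \<in> states (machine ts N) - (accepting (machine ts N) \<union> rejecting (machine ts N)). \<forall>a b.
      \<forall>(q', m1, m2) \<in> set_pmf (trans (machine ts N) s a b).
        q' \<in> states (machine ts N) \<and> (a = Right_End \<longrightarrow> m1 = Stay) \<and> (b = Right_End \<longrightarrow> m2 = Stay)"
    by blast
  moreover have "initial (machine ts N) \<in> states (machine ts N)"
    "accepting (machine ts N) \<subseteq> states (machine ts N)"
    "rejecting (machine ts N) \<subseteq> states (machine ts N)"
    "accepting (machine ts N) \<inter> rejecting (machine ts N) = {}"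
    by (simp_all add: machine_def)
  ultimately show ?thesis
    using fin unfolding wf_two_tape_pfa_def by (intro conjI)
qed

section \<open>The deterministic run after the random draw\<close>

definition scan_conf :: "letter list \<Rightarrow> letter list \<Rightarrow> nat \<times> nat \<times> nat \<Rightarrow> nat \<times> nat \<times> nat" where
  "scan_conf u v = (\<lambda>(s, i, j). if s \<in> {1, 2} then (s, i, j) else
     (case scan_step (from_nat (s - 3)) (tape u ! i) (tape v ! j) of
        (s', m1, m2) \<Rightarrow> (s', move_head m1 i, move_head m2 j)))"

definition scan_run :: "test \<times> nat \<Rightarrow> letter list \<Rightarrow> letter list \<Rightarrow> nat \<Rightarrow> nat \<times> nat \<times> nat" where
  "scan_run d u v n = (scan_conf u v ^^ n) (running (d, 0, 0, 0), 1, 1)"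

lemma scan_run_simps:
  "scan_run d u v 0 = (running (d, 0, 0, 0), 1, 1)"
  "scan_run d u v (Suc n) = scan_conf u v (scan_run d u v n)"
  by (simp_all add: scan_run_def)

lemma fst_scan_conf: "fst c \<noteq> 0 \<Longrightarrow> fst (scan_conf u v c) \<noteq> 0"
proof -
  have "fst (scan_step s a b) \<noteq> 0" for s a b
    by (cases s) (auto simp: scan_step.simps split: tape_symbol.split letter.split)
  then have "fst (case scan_step s a b of (s', m1, m2) \<Rightarrow> (s', move_head m1 i, move_head m2 j)) \<noteq> 0"
    for s a b i j
    by (metis (no_types, lifting) fst_conv prod.case_eq_if)
  then show "fst c \<noteq> 0 \<Longrightarrow> fst (scan_conf u v c) \<noteq> 0"
    unfolding scan_conf_def by (cases c) simp
qed

lemma fst_scan_run: "fst (scan_run d u v n) \<noteq> 0"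
  by (induction n) (simp_all add: scan_run_simps fst_scan_conf)

lemma step_machine: "fst c \<noteq> 0 \<Longrightarrow> step (machine ts N) u v c = return_pmf (scan_conf u v c)"
  by (cases c) (auto simp: machine_def scan_conf_def map_return_pmf split: prod.split)

text \<open>All randomness lies in the first step: state 0 is never entered again, and at every
  other state \<open>step\<close> is a point mass.\<close>

lemma run_machine:
  "run (machine ts N) u v (Suc n) =
     map_pmf (\<lambda>(i, r). scan_run (ts ! i, r) u v n) (pmf_of_set ({..<length ts} \<times> {1..N}))"
proof (induction n)
  case 0
  show ?case
    by (simp add: machine_def tape_def bind_return_pmf map_pmf_comp scan_run_simps case_prod_beta)
next
  case (Suc n)
  show ?case
    unfolding run.simps(2)[of _ _ _ "Suc n"] Suc
    by (simp add: map_pmf_def bind_assoc_pmf bind_return_pmf case_prod_beta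
        step_machine[OF fst_scan_run] scan_run_simps)
qed

section \<open>Correctness of the scan for a fixed draw\<close>

definition scan_value :: "test \<times> nat \<Rightarrow> letter list \<Rightarrow> letter list \<Rightarrow> int" where
  "scan_value d u v = int (weight (weight1 d) u) - int (weight (weight2 d) v)"

text \<open>The counter leaves the interval only after one tape is exhausted; from then on it moves
  monotonically away from 0, so clipping does not affect whether it ends at 0.\<close>

definition scan_inv :: "test \<times> nat \<Rightarrow> letter list \<Rightarrow> letter list \<Rightarrow> nat \<Rightarrow> nat \<Rightarrow> nat \<times> nat \<times> nat \<Rightarrow> bool" where
  "scan_inv d u v i j c \<longleftrightarrow> i \<le> length u \<and> j \<le> length v \<and>
     (scan_value d (take i u) (take j v) < - bound d \<longrightarrow> i = length u) \<and>
     (scan_value d (take i u) (take j v) > bound d \<longrightarrow> j = length v) \<and>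
     c = (running (d, min 3 (count_list (take i u) Nabla), min 3 (count_list (take j v) Nabla),
            clip (bound d) (scan_value d (take i u) (take j v))), Suc i, Suc j)"

text \<open>If a test mentions only blocks 0, 1 and 2, a separator count capped at 3 still selects
  the right weight, namely 0 from block 3 on.\<close>

definition narrow :: "test \<Rightarrow> bool" where
  "narrow t \<longleftrightarrow> set (snd t) \<subseteq> {..<3} \<times> {..<3}"

lemma weight_min:
  assumes "narrow (fst d)"
  shows "weight1 d (min 3 p) = weight1 d p" "weight2 d (min 3 p) = weight2 d p"
proof -
  have "k \<notin> set (map fst (snd (fst d)))" "k \<notin> set (map snd (snd (fst d)))" if "k \<ge> 3" for k
    using assms that by (auto simp: narrow_def)
  then show "weight1 d (min 3 p) = weight1 d p" "weight2 d (min 3 p) = weight2 d p"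
    unfolding weight1_def weight2_def by (cases "p \<le> 3"; simp add: horner_outside)+
qed

lemma tape_Suc: "tape w ! Suc i = (if i < length w then Letter (w ! i) else Right_End)"
  if "i \<le> length w"
  using that by (auto simp: tape_def nth_append)

lemma scan_conf_running:
  assumes "i \<le> length u" "j \<le> length v" "narrow (fst d)"
  shows "scan_conf u v (running (d, min 3 p, min 3 q, z), Suc i, Suc j) =
    (if i = length u \<and> j = length v then
       (if p = 2 \<and> q = 1 \<and> (z = 0 \<longleftrightarrow> fst (fst d)) then 1 else 2, Suc i, Suc j)
     else if j = length v \<or> (z \<le> 0 \<and> i \<noteq> length u) then
       (if u ! i = One then running (d, min 3 p, min 3 q, clip (bound d) (z + int (weight1 d p)))
        else running (d, min 3 (Suc p), min 3 q, z), Suc (Suc i), Suc j)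
     else
       (if v ! j = One then running (d, min 3 p, min 3 q, clip (bound d) (z - int (weight2 d q)))
        else running (d, min 3 p, min 3 (Suc q), z), Suc i, Suc (Suc j)))"
proof -
  \<comment> \<open>The cap exceeds the required counts 2 and 1, so the final check can be stated
    for the true counts.\<close>
  have [simp]: "min 3 p = 2 \<longleftrightarrow> p = 2" "min 3 q = Suc 0 \<longleftrightarrow> q = Suc 0"
    "min 2 (min 3 p) = min 2 p" "min 2 (min 3 q) = min 2 q"
    by (simp_all add: min_def)
  have "scan_conf u v (running (d, min 3 p, min 3 q, z), Suc i, Suc j) =
    (case scan_step (d, min 3 p, min 3 q, z) (tape u ! Suc i) (tape v ! Suc j) of
        (s', m1, m2) \<Rightarrow> (s', move_head m1 (Suc i), move_head m2 (Suc j)))"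
    by (simp add: scan_conf_def)
  then show ?thesis
    using assms(1,2)
    by (cases "u ! i"; cases "v ! j") (simp_all add: scan_step.simps tape_Suc weight_min[OF assms(3)])
qed

lemma scan_inv_step:
  assumes inv: "scan_inv d u v i j c" and "narrow (fst d)" and less: "i + j < length u + length v"
  shows "scan_inv d u v (Suc i) j (scan_conf u v c) \<or> scan_inv d u v i (Suc j) (scan_conf u v c)"
proof -
  define Z where "Z = scan_value d (take i u) (take j v)"
  define p where "p = count_list (take i u) Nabla"
  define q where "q = count_list (take j v) Nabla"
  have ij: "i \<le> length u" "j \<le> length v"
    and lo: "Z < - bound d \<Longrightarrow> i = length u" and hi: "Z > bound d \<Longrightarrow> j = length v"
    and c: "c = (running (d, min 3 p, min 3 q, clip (bound d) Z), Suc i, Suc j)"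
    using inv unfolding scan_inv_def Z_def p_def q_def by blast+
  note conf = scan_conf_running[OF ij assms(2), of p q "clip (bound d) Z", folded c]
  have pos: "bound d \<ge> 1" by (rule bound_pos)
  show ?thesis
  proof (cases "j = length v \<or> (Z \<le> 0 \<and> i \<noteq> length u)")
    case True
    with less ij have i: "i < length u" by auto
    define w where "w = (if u ! i = One then int (weight1 d p) else 0)"
    have w: "0 \<le> w" "w \<le> bound d" using weight1_le[of d p] pos by (auto simp: w_def)
    \<comment> \<open>Tape 1 is not exhausted, so by the invariant the value is not below the
      interval, and the addition is compatible with clipping.\<close>
    have lo': "- bound d \<le> Z" using lo i by fastforce
    have tk: "take (Suc i) u = take i u @ [u ! i]" using i by (simp add: take_Suc_conv_app_nth)
    have Z': "scan_value d (take (Suc i) u) (take j v) = Z + w"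
      by (simp add: tk scan_value_def weight_snoc Z_def p_def w_def)
    have p': "count_list (take (Suc i) u) Nabla = (if u ! i = One then p else Suc p)"
      by (cases "u ! i") (simp_all add: tk p_def)
    have "scan_conf u v c = (running (d, min 3 (if u ! i = One then p else Suc p), min 3 q,
        clip (bound d) (Z + w)), Suc (Suc i), Suc j)"
      using True i unfolding conf clip_sign(1)[OF pos] clip_add[OF w(1) lo', symmetric]
      by (auto simp: w_def clip_add[OF order_refl lo', simplified])
    \<comment> \<open>From a value at most 0, one letter cannot exceed \<open>bound d\<close>;
      otherwise tape 2 is already exhausted.\<close>
    moreover have "Z + w \<le> bound d \<or> j = length v" "- bound d \<le> Z + w"
      using True w lo' by auto
    ultimately have "scan_inv d u v (Suc i) j (scan_conf u v c)"
      using i ij(2) unfolding scan_inv_def Z' p' q_def by auto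
    then show ?thesis ..
  next
    case False
    \<comment> \<open>Mirror image: tape 2 is read because the value is positive or tape 1 is
      exhausted.\<close>
    with ij have j: "j < length v" by auto
    define w where "w = (if v ! j = One then int (weight2 d q) else 0)"
    have w: "0 \<le> w" "w \<le> bound d" using weight2_le[of d q] pos by (auto simp: w_def)
    have hi': "Z \<le> bound d" using hi j by fastforce
    have tk: "take (Suc j) v = take j v @ [v ! j]" using j by (simp add: take_Suc_conv_app_nth)
    have Z': "scan_value d (take i u) (take (Suc j) v) = Z - w"
      by (simp add: tk scan_value_def weight_snoc Z_def q_def w_def)
    have q': "count_list (take (Suc j) v) Nabla = (if v ! j = One then q else Suc q)"
      by (cases "v ! j") (simp_all add: tk q_def)
    have "0 \<le> bound d" using pos by simp
    note clip = clip_diff[OF _ hi' this]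
    have "scan_conf u v c = (running (d, min 3 p, min 3 (if v ! j = One then q else Suc q),
        clip (bound d) (Z - w)), Suc i, Suc (Suc j))"
      using False j unfolding conf clip_sign(1)[OF pos] clip[OF w(1), symmetric]
      by (auto simp: w_def clip[OF order_refl, simplified])
    moreover have "- bound d \<le> Z - w \<or> i = length u" "Z - w \<le> bound d"
      using False w hi' ij by auto
    ultimately have "scan_inv d u v i (Suc j) (scan_conf u v c)"
      using j ij(1) unfolding scan_inv_def Z' q' p_def by auto
    then show ?thesis ..
  qed
qed

text \<open>Each step advances exactly one head, so the numbers of letters read add up to n.\<close>

lemma scan_inv_run:
  assumes "narrow (fst d)"
  shows "n \<le> length u + length v \<Longrightarrow> \<exists>i j. i + j = n \<and> scan_inv d u v i j (scan_run d u v n)"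
proof (induction n)
  case 0
  show ?case
    using bound_pos[of d] by (auto simp: scan_inv_def scan_run_simps scan_value_def clip_def)
next
  case (Suc n)
  then obtain i j where ij: "i + j = n" "scan_inv d u v i j (scan_run d u v n)" by auto
  with scan_inv_step[OF ij(2) assms] Suc.prems
  have "scan_inv d u v (Suc i) j (scan_run d u v (Suc n)) \<or>
        scan_inv d u v i (Suc j) (scan_run d u v (Suc n))"
    by (auto simp: scan_run_simps)
  with ij(1) show ?case
    by (metis add_Suc add_Suc_right)
qed

definition verdict :: "test \<times> nat \<Rightarrow> letter list \<Rightarrow> letter list \<Rightarrow> bool" where
  "verdict d u v \<longleftrightarrow> count_list u Nabla = 2 \<and> count_list v Nabla = 1 \<and>
     (balanced (snd (fst d)) (snd d) u v \<longleftrightarrow> fst (fst d))"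

lemma fst_scan_run_end:
  assumes "narrow (fst d)"
  shows "fst (scan_run d u v (Suc (length u + length v))) = (if verdict d u v then 1 else 2)"
proof -
  define Z where "Z = scan_value d u v"
  obtain i j where ij: "i + j = length u + length v"
    and inv: "scan_inv d u v i j (scan_run d u v (length u + length v))"
    using scan_inv_run[OF assms order_refl] by blast
  have "i \<le> length u" "j \<le> length v"
    using inv unfolding scan_inv_def by blast+
  \<comment> \<open>Two bounded positions with maximal sum are both maximal, so the next step sees
    \<open>Right_End\<close> twice and halts.\<close>
  with ij have eq: "i = length u" "j = length v" by simp_all
  have "scan_run d u v (length u + length v) =
      (running (d, min 3 (count_list u Nabla), min 3 (count_list v Nabla), clip (bound d) Z),
        Suc (length u), Suc (length v))"
    using inv unfolding scan_inv_def eq take_all[OF order_refl] Z_def by blast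
  moreover have "Z = 0 \<longleftrightarrow> balanced (snd (fst d)) (snd d) u v"
    by (simp add: Z_def scan_value_def balanced_def weight1_def weight2_def)
  ultimately show ?thesis
    using clip_sign(2)[OF bound_pos, of d Z]
    by (simp add: scan_run_simps(2) scan_conf_running[OF order_refl order_refl assms] verdict_def)
qed

section \<open>The probability of a correct answer\<close>

text \<open>This is the answer of an error-free test. It can differ from \<open>verdict\<close> only
  if the equations fail and yet balance for the chosen r.\<close>

definition ideal :: "test \<Rightarrow> letter list \<Rightarrow> letter list \<Rightarrow> bool" where
  "ideal t u v \<longleftrightarrow> count_list u Nabla = 2 \<and> count_list v Nabla = 1 \<and>
     (equal_on (snd t) u v \<longleftrightarrow> fst t)"

text \<open>One step draws, one step per letter scans, and one step halts; hence the two successors.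
  The uniform draw turns the probability into a count.\<close>

lemma prob_within_machine:
  assumes "\<forall>t \<in> set ts. narrow t" "ts \<noteq> []" "N > 0"
  shows "prob_within (machine ts N) {if b then 1 else 2} u v (Suc (Suc (length u + length v))) =
    card {(i, r) \<in> {..<length ts} \<times> {1..N}. verdict (ts ! i, r) u v = b} / (length ts * N)"
proof -
  let ?S = "{..<length ts} \<times> {1..N}"
  have S: "?S \<noteq> {}" "finite ?S" using assms by auto
  have halt: "fst (scan_run (ts ! i, r) u v (Suc (length u + length v))) = (if b then 1 else 2) \<longleftrightarrow>
      verdict (ts ! i, r) u v = b" if "i < length ts" for i r
    using fst_scan_run_end[of "(ts ! i, r)" u v] assms(1) that by auto
  have "?S \<inter> (\<lambda>(i, r). scan_run (ts ! i, r) u v (Suc (length u + length v))) -` {c. fst c = (if b then 1 else 2)}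
     = {(i, r) \<in> ?S. verdict (ts ! i, r) u v = b}"
    using halt by (auto simp del: One_nat_def)
  then show ?thesis
    unfolding prob_within_def run_machine
    using S by (simp add: measure_pmf_of_set)
qed

text \<open>At most k values of r mislead a test with at most k + 1 equations, so the loss against
  error-free tests is at most \<open>k / N\<close>. The parameter b treats acceptance and rejection
  at once.\<close>

lemma prob_within_machine_ge:
  assumes "\<forall>t \<in> set ts. narrow t \<and> length (snd t) \<le> Suc k" "ts \<noteq> []" "N > 0"
  shows "prob_within (machine ts N) {if b then 1 else 2} u v (Suc (Suc (length u + length v))) \<ge>
    length (filter (\<lambda>t. ideal t u v = b) ts) / length ts - k / N"
proof -
  let ?S = "{..<length ts} \<times> {1..N}"
  define I where "I = {i. i < length ts \<and> ideal (ts ! i) u v = b}"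
  define V where "V = {(i, r) \<in> ?S. verdict (ts ! i, r) u v = b}"
  define B where "B = (SIGMA i : {i \<in> {..<length ts}. \<not> equal_on (snd (ts ! i)) u v}.
    {r. balanced (snd (ts ! i)) r u v})"
  have finV: "finite V" unfolding V_def by (rule finite_subset[of _ ?S]) auto
  have finB: "finite B"
    unfolding B_def by (intro finite_SigmaI) (auto simp: card_spurious_balance)
  have "card B \<le> (\<Sum>i | i \<in> {..<length ts} \<and> \<not> equal_on (snd (ts ! i)) u v. k)"
    unfolding B_def
  proof (subst card_SigmaI)
    show "(\<Sum>i | i \<in> {..<length ts} \<and> \<not> equal_on (snd (ts ! i)) u v.
        card {r. balanced (snd (ts ! i)) r u v}) \<le>
      (\<Sum>i | i \<in> {..<length ts} \<and> \<not> equal_on (snd (ts ! i)) u v. k)"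
    proof (intro sum_mono)
      fix i assume i: "i \<in> {i. i \<in> {..<length ts} \<and> \<not> equal_on (snd (ts ! i)) u v}"
      then have "length (snd (ts ! i)) \<le> Suc k" using assms(1) by auto
      with card_spurious_balance(2)[of "snd (ts ! i)" u v] i
      show "card {r. balanced (snd (ts ! i)) r u v} \<le> k" by auto
    qed
  qed (auto simp: card_spurious_balance)
  also have "\<dots> \<le> (\<Sum>i<length ts. k)"
    by (rule sum_mono2) auto
  finally have cardB: "card B \<le> length ts * k" by simp
  \<comment> \<open>Equations that hold balance for every r; equations that fail balance only on
    \<open>B\<close>. Outside \<open>B\<close> the ideal answer and the verdict therefore
    agree.\<close>
  have "I \<times> {1..N} \<subseteq> V \<union> B"
    by (auto simp: I_def V_def B_def ideal_def verdict_def balanced_if_equal_on)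
  then have "card (I \<times> {1..N}) \<le> card (V \<union> B)"
    by (rule card_mono[rotated]) (use finV finB in simp)
  also have "\<dots> \<le> card V + card B" by (rule card_Un_le)
  finally have "card I * N \<le> card V + length ts * k"
    using cardB by (simp add: card_cartesian_product)
  then have "real (card I) * N - real (length ts) * k \<le> card V"
    by (metis of_nat_le_iff of_nat_add of_nat_mult diff_le_eq)
  then have "(real (card I) * N - real (length ts) * k) / (length ts * N) \<le>
      card V / (length ts * N)"
    by (rule divide_right_mono) simp
  also have "(real (card I) * N - real (length ts) * k) / (length ts * N) =
      card I / length ts - k / N"
    using assms(2,3) by (simp add: diff_divide_distrib)
  finally show ?thesis
    using prob_within_machine[of ts N b u v] assms
    by (simp add: I_def V_def length_filter_conv_card)
qed

lemma accept_prob_ge: "accept_prob A u v \<ge> prob_within A (accepting A) u v n"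
  unfolding accept_prob_def
  by (rule cSUP_upper) (auto simp: prob_within_def intro!: bdd_aboveI[where M = 1])

lemma reject_prob_ge: "reject_prob A u v \<ge> prob_within A (rejecting A) u v n"
  unfolding reject_prob_def
  by (rule cSUP_upper) (auto simp: prob_within_def intro!: bdd_aboveI[where M = 1])

section \<open>Unary blocks and membership in the language\<close>

lemma count_Nabla_0: "count_list w Nabla = 0 \<longleftrightarrow> (\<exists>a. w = replicate a One)"
proof
  show "\<exists>a. w = replicate a One" if "count_list w Nabla = 0"
    using that
  proof (induction w)
    case (Cons a w)
    then show ?case by (cases a) (auto simp flip: replicate_Suc split: if_splits)
  qed simp
qed (auto simp: count_list_0_iff)

lemma count_Nabla_Suc:
  "count_list w Nabla = Suc n \<longleftrightarrow>
     (\<exists>a w'. w = replicate a One @ Nabla # w' \<and> count_list w' Nabla = n)"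
proof
  assume *: "count_list w Nabla = Suc n"
  then have "Nabla \<in> set w" by (metis count_list_0_iff nat.distinct(1))
  then obtain us w' where w: "w = us @ Nabla # w'" "Nabla \<notin> set us"
    by (meson split_list_first)
  then have "count_list us Nabla = 0" by (simp add: count_list_0_iff)
  then obtain a where "us = replicate a One" by (auto simp: count_Nabla_0)
  with * w show "\<exists>a w'. w = replicate a One @ Nabla # w' \<and> count_list w' Nabla = n"
    by auto
qed (auto simp: count_Nabla_0[THEN iffD2, OF exI, OF refl])

definition exactly_two :: "letter list \<Rightarrow> nat \<Rightarrow> bool" where
  "exactly_two u n \<longleftrightarrow>
     of_bool (block u 0 = n) + of_bool (block u 1 = n) + of_bool (block u 2 = n) = (2::nat)"

lemma block_simps:
  "block (replicate n One) i = (if i = 0 then n else 0)"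
  "block (replicate n One @ Nabla # w) 0 = n"
  "block (replicate n One @ Nabla # w) (Suc i) = block w i"
  using weight_replicate_One[of _ n "[]"] by (simp_all add: block_def comp_def)

lemma lists_One_eq:
  assumes "w \<in> lists {One}"
  shows "w = replicate (length w) One"
  using assms by (induction w) auto

lemma card_filter_three:
  "card {j \<in> {1, 2, 3}. P j} = of_bool (P 1) + of_bool (P 2) + of_bool (P (3::nat))"
proof -
  have "{j \<in> {1, 2, 3}. P j} =
      (if P 1 then {1} else {}) \<union> (if P 2 then {2} else {}) \<union> (if P (3::nat) then {3} else {})"
    by auto
  then show ?thesis by simp
qed

lemma ex1_two: "(\<exists>!k. k \<in> {1, 2} \<and> P k) \<longleftrightarrow> P 1 \<noteq> P (2::nat)"
proof (cases "P 1")
  case True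
  then show ?thesis by (metis insertCI insertE empty_iff one_eq_numeral_iff semiring_norm(85))
next
  case False
  then show ?thesis by (metis insertCI insertE empty_iff)
qed

text \<open>Unary words are determined by their lengths, so equality of parts becomes equality of
  block lengths. Parts numbered from 1 become blocks numbered from 0.\<close>

lemma L3_iff:
  "(u, v) \<in> L3 \<longleftrightarrow> count_list u Nabla = 2 \<and> count_list v Nabla = 1 \<and>
     (exactly_two u (block v 0) \<noteq> exactly_two u (block v 1))"
proof -
  define unary where "unary a j = replicate (a j) One" for a :: "nat \<Rightarrow> nat" and j
  define word1 where
    "word1 x = (x 1 @ [Nabla] @ x 2 @ [Nabla] @ x 3)" for x :: "nat \<Rightarrow> letter list"
  define word2 where
    "word2 y = (y 1 @ [Nabla] @ y 2)" for y :: "nat \<Rightarrow> letter list"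
  define unique where
    "unique x y \<longleftrightarrow> (\<exists>!k. k \<in> {1, 2} \<and> card {j \<in> {1, 2, 3}. x j = y k} = 2)"
    for x y :: "nat \<Rightarrow> letter list"
  have L3: "(u, v) \<in> L3 \<longleftrightarrow> (\<exists>x y. u = word1 x \<and> v = word2 y \<and>
      (\<forall>j \<in> {1, 2, 3}. x j \<in> lists {One}) \<and> (\<forall>k \<in> {1, 2}. y k \<in> lists {One}) \<and> unique x y)"
    unfolding L3_def word1_def word2_def unique_def mem_Collect_eq prod.inject
    by (simp only: conj_assoc)
  have counts: "count_list (word1 (unary a)) Nabla = 2" "count_list (word2 (unary b)) Nabla = 1"
    for a b
    by (simp_all add: word1_def word2_def unary_def count_list_append)
  have key: "unique (unary a) (unary b) \<longleftrightarrow>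
      exactly_two (word1 (unary a)) (block (word2 (unary b)) 0) \<noteq>
      exactly_two (word1 (unary a)) (block (word2 (unary b)) 1)" for a b
    unfolding unique_def ex1_two card_filter_three exactly_two_def
    by (simp add: word1_def word2_def unary_def block_simps numeral_2_eq_2)
  show ?thesis
  proof
    assume "(u, v) \<in> L3"
    then obtain x y where xy: "u = word1 x" "v = word2 y" "unique x y"
      "\<forall>j \<in> {1, 2, 3}. x j \<in> lists {One}" "\<forall>k \<in> {1, 2}. y k \<in> lists {One}"
      unfolding L3 by blast
    define a where "a j = length (x j)" for j
    define b where "b j = length (y j)" for j
    have x: "x 1 = unary a 1" "x 2 = unary a 2" "x 3 = unary a 3"
      and y: "y 1 = unary b 1" "y 2 = unary b 2"
      using xy(4,5) unfolding unary_def a_def b_def by (blast intro: lists_One_eq)+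
    have "u = word1 (unary a)" "v = word2 (unary b)"
      by (simp_all only: xy(1,2) word1_def word2_def x y)
    moreover have "unique (unary a) (unary b)"
      using xy(3) unfolding unique_def ex1_two card_filter_three x y .
    ultimately show "count_list u Nabla = 2 \<and> count_list v Nabla = 1 \<and>
        (exactly_two u (block v 0) \<noteq> exactly_two u (block v 1))"
      using key counts by simp
  next
    assume *: "count_list u Nabla = 2 \<and> count_list v Nabla = 1 \<and>
        (exactly_two u (block v 0) \<noteq> exactly_two u (block v 1))"
    then have "count_list u Nabla = Suc (Suc 0)" "count_list v Nabla = Suc 0" by simp_all
    then obtain a1 a2 a3 b1 b2 where
      "u = replicate a1 One @ Nabla # replicate a2 One @ Nabla # replicate a3 One"
      "v = replicate b1 One @ Nabla # replicate b2 One"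
      unfolding count_Nabla_Suc count_Nabla_0 by blast
    \<comment> \<open>Only the indices 1, 2, 3 and 1, 2 are read; the last branch of each function
      also supplies the default value.\<close>
    then have uv: "u = word1 (unary (\<lambda>j. if j = 1 then a1 else if j = 2 then a2 else a3))"
      "v = word2 (unary (\<lambda>j. if j = 1 then b1 else b2))"
      by (simp_all add: word1_def word2_def unary_def)
    with * key have "unique (unary (\<lambda>j. if j = 1 then a1 else if j = 2 then a2 else a3))
        (unary (\<lambda>j. if j = 1 then b1 else b2))"
      by blast
    moreover have "unary a j \<in> lists {One}" for a j
      by (auto simp: unary_def)
    ultimately show "(u, v) \<in> L3"
      unfolding L3 using uv by blast
  qed
qed

section \<open>The 25 tests\<close>

definition pair_tests :: "test list" where
  "pair_tests = [(True, [(i, k), (j, k)]). (i, j) \<leftarrow> [(0, 1), (0, 2), (1, 2)], k \<leftarrow> [0, 1]]"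

definition column_tests :: "test list" where
  "column_tests = [(False, [(0, k), (1, k), (2, k)]). k \<leftarrow> [0, 1]]"

text \<open>Three equations suffice, since they chain x_i = y_1 = x_j = y_2; at most two values of r
  are then misleading.\<close>

definition square_tests :: "test list" where
  "square_tests = [(False, [(i, 0), (j, 0), (j, 1)]). (i, j) \<leftarrow> [(0, 1), (0, 2), (1, 2)]]"

definition L3_tests :: "test list" where
  "L3_tests = replicate 7 (False, []) @ pair_tests @
     column_tests @ column_tests @ column_tests @ square_tests @ square_tests"

lemma length_L3_tests: "length L3_tests = 25"
  by (simp add: L3_tests_def pair_tests_def column_tests_def square_tests_def)

text \<open>Let m_k be the number of j with x_j = y_k, and count accepting pair, column and square
  tests in this order. If y_1 and y_2 differ, then m_1 + m_2 \<le> 3, and the totals are 1 + 6 + 6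
  if some m_k = 2, 3 + 3 + 6 if some m_k = 3, and 0 + 6 + 6 otherwise. If y_1 = y_2, the common m
  gives 0 + 6 + 6 for m \<le> 1, 2 + 6 + 4 for m = 2, and 6 + 0 + 0 for m = 3.\<close>

lemma L3_tests_majority:
  "length (filter (\<lambda>t. ideal t u v = ((u, v) \<in> L3)) L3_tests) \<ge> 13"
proof (cases "count_list u Nabla = 2 \<and> count_list v Nabla = 1")
  case False
  then have "(u, v) \<notin> L3" "\<not> ideal t u v" for t
    unfolding L3_iff ideal_def by blast+
  then show ?thesis by (simp add: length_L3_tests)
next
  case True
  define a b where "a i \<longleftrightarrow> block u i = block v 0" and "b i \<longleftrightarrow> block u i = block v 1" for i
  have length_filter_Cons: "length (filter P (t # ts)) = of_bool (P t) + length (filter P ts)"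
    for P and t :: test and ts
    by simp
  have ideal: "ideal t u v \<longleftrightarrow> (equal_on (snd t) u v \<longleftrightarrow> fst t)" for t
    using True by (simp add: ideal_def)
  have in_L3: "(u, v) \<in> L3 \<longleftrightarrow> exactly_two u (block v 0) \<noteq> exactly_two u (block v 1)"
    using True by (simp add: L3_iff)
  have equal_on: "equal_on [] u v"
    "equal_on ((i, j) # es) u v \<longleftrightarrow> block u i = block v j \<and> equal_on es u v" for i j es
    by (auto simp: equal_on_def)
  note count = ideal in_L3 exactly_two_def L3_tests_def pair_tests_def column_tests_def
    square_tests_def filter_append length_append filter_replicate list.map concat.simps prod.case
    append.simps length_filter_Cons fst_conv snd_conv equal_on simp_thms
    a_def[symmetric] b_def[symmetric] filter.simps(1) list.size(3) add_0_right
  show ?thesis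
  proof (cases "block v 0 = block v 1")
    case True
    then have "b = a" by (simp add: fun_eq_iff a_def b_def)
    then show ?thesis
      by (simp only: count, cases "a 0"; cases "a 1"; cases "a 2"; simp)
  next
    case False
    \<comment> \<open>No block matches two different blocks of tape 2; with this a finite Boolean
      check remains.\<close>
    then have "\<not> (a i \<and> b i)" for i by (simp add: a_def b_def)
    from this[of 0] this[of 1] this[of 2] show ?thesis
      by (simp only: count, cases "a 0"; cases "a 1"; cases "a 2";
          cases "b 0"; cases "b 1"; cases "b 2"; simp)
  qed
qed

theorem theorem3p6:
  fixes \<epsilon> :: real
  assumes "\<epsilon> > 0"
  shows "\<exists>A :: (nat, letter) two_tape_pfa.
           wf_two_tape_pfa A \<and> recognizes A L3 (13 / 25 - \<epsilon>)"
proof -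
  obtain n where n: "inverse (real (Suc n)) < \<epsilon> / 2"
    using reals_Archimedean[of "\<epsilon> / 2"] assms by auto
  define N where "N = Suc n"
  \<comment> \<open>No test has more than three equations, so at most two values of r mislead it,
    and this N keeps the loss within \<epsilon>.\<close>
  have N: "N > 0" "2 / real N \<le> \<epsilon>"
    using n by (simp_all add: N_def field_simps)
  define A where "A = machine L3_tests N"
  have tests: "\<forall>t \<in> set L3_tests. narrow t \<and> length (snd t) \<le> Suc 2" "L3_tests \<noteq> []"
    by (auto simp: L3_tests_def pair_tests_def column_tests_def square_tests_def narrow_def)
  have main: "prob_within A {if (u, v) \<in> L3 then 1 else 2} u v (Suc (Suc (length u + length v)))
      \<ge> 13 / 25 - \<epsilon>" for u v
  proof -
    have "13 / 25 - \<epsilon> \<le> real (length (filter (\<lambda>t. ideal t u v = ((u, v) \<in> L3)) L3_tests))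
        / length L3_tests - 2 / N"
      using L3_tests_majority[of u v] N(2) unfolding length_L3_tests by simp
    also have "\<dots> \<le> prob_within A {if (u, v) \<in> L3 then 1 else 2} u v (Suc (Suc (length u + length v)))"
      using prob_within_machine_ge[OF tests(1,2) N(1), where b = "(u, v) \<in> L3"] unfolding A_def by simp
    finally show ?thesis .
  qed
  have "recognizes A L3 (13 / 25 - \<epsilon>)"
    unfolding recognizes_def
  proof (intro allI conjI impI)
    fix u v
    have acc: "accepting A = {1}" and rej: "rejecting A = {2}"
      by (simp_all add: A_def machine_def)
    show "accept_prob A u v \<ge> 13 / 25 - \<epsilon>" if "(u, v) \<in> L3"
      using main[of u v] accept_prob_ge[of A u v] that unfolding acc
      by (auto intro: order_trans)
    show "reject_prob A u v \<ge> 13 / 25 - \<epsilon>" if "(u, v) \<notin> L3"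
      using main[of u v] reject_prob_ge[of A u v] that unfolding rej
      by (auto intro: order_trans)
  qed
  moreover have "wf_two_tape_pfa A"
    unfolding A_def by (rule wf_machine[OF tests(2) N(1)])
  ultimately show ?thesis by blast
qed

end
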